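(* Let $f,g,h,k$ be complex numbers with $f\neq 0$ and $g\neq 0$, and let $(R_n)_{n\in\mathbb{Z}}$ be the two-sided sequence with $R_0=h$, $R_1=k$ and $R_{n+1}=fR_n+gR_{n-1}$ for all $n\in\mathbb{Z}$. Then for all integers $n$ and $i$, $$(k^{2}-fkh-gh^{2})R_{i+n}+(f^{2}h-fk+gh)R_{i}R_{n}+hg^{2}R_{i-1}R_{n-1}+(fh-k)g\left(R_{n}R_{i-1}+R_{i}R_{n-1}\right)=0.$$
   Context: The paper works with complex functions $f(z),g(z),h(z),k(z)$ evaluated at a fixed $z$, with the standing assumption $f\neq0$, $g\neq0$. Since $g\neq0$, the sequence extends to negative indices via $R_{n-1}=(R_{n+1}-fR_n)/g$. *)

theory Defs
  imports Complex_Main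
begin

end

theory Submission
  imports Defs
begin

text \<open>
  For fixed \<open>i\<close>, the left-hand side is a solution, as a function of \<open>n\<close>, of the same
  recurrence as \<open>R\<close>. Since \<open>g \<noteq> 0\<close>, a two-sided solution is determined by its
  values at \<open>0\<close> and \<open>1\<close>, and both values vanish.
\<close>

lemma two_sided_recurrence_eq_0:
  fixes F :: "int \<Rightarrow> 'a::idom"
  assumes "g \<noteq> 0" and "F 0 = 0" and "F 1 = 0"
    and rec: "\<And>n. F (n + 1) = f * F n + g * F (n - 1)"
  shows "F n = 0"
proof -
  \<comment> \<open>Two consecutive zeros form the state of a second-order recurrence, so this pair
    can be carried in both directions.\<close>
  have "F n = 0 \<and> F (n + 1) = 0"
  proof (induction n rule: int_induct[where k = 0])
    case base
    show ?case using assms by simp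
  next
    case (step1 i)
    then show ?case using rec[of "i + 1"] by simp
  next
    case (step2 i)
    \<comment> \<open>Read backwards, the recurrence gives \<open>g * F (i - 1) = 0\<close>, and
      \<open>g\<close> cancels in an integral domain.\<close>
    then show ?case using rec[of i] \<open>g \<noteq> 0\<close> by auto
  qed
  then show ?thesis ..
qed

theorem theorem4p2:
  fixes f g h k :: complex and R :: "int \<Rightarrow> complex"
  assumes "f \<noteq> 0" and "g \<noteq> 0"
    and "R 0 = h" and "R 1 = k"
    and "\<And>n. R (n + 1) = f * R n + g * R (n - 1)"
  shows "\<forall>n i :: int.
    (k\<^sup>2 - f * k * h - g * h\<^sup>2) * R (i + n)
      + (f\<^sup>2 * h - f * k + g * h) * R i * R n
      + h * g\<^sup>2 * R (i - 1) * R (n - 1)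
      + (f * h - k) * g * (R n * R (i - 1) + R i * R (n - 1)) = 0"
proof (intro allI)
  fix n i :: int
  note rec = assms(5)
  define F where "F m =
    (k\<^sup>2 - f * k * h - g * h\<^sup>2) * R (i + m)
      + (f\<^sup>2 * h - f * k + g * h) * R i * R m
      + h * g\<^sup>2 * R (i - 1) * R (m - 1)
      + (f * h - k) * g * (R m * R (i - 1) + R i * R (m - 1))" for m
  have "F n = 0"
  proof (rule two_sided_recurrence_eq_0[OF \<open>g \<noteq> 0\<close>])
    have "k = f * h + g * R (- 1)"
      using rec[of 0] assms(3,4) by simp
    then show "F 0 = 0"
      unfolding F_def using assms(3) by (simp add: algebra_simps power2_eq_square)
    show "F 1 = 0"
      unfolding F_def rec[of i] using assms(3,4) by (simp add: algebra_simps power2_eq_square)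
    show "F (m + 1) = f * F m + g * F (m - 1)" for m
    proof -
      \<comment> \<open>\<open>F m\<close> is linear in \<open>R (i + m)\<close>, \<open>R m\<close>
        and \<open>R (m - 1)\<close> with coefficients free of \<open>m\<close>, so the recurrence
        for each of the three carries over to \<open>F\<close>.\<close>
      have "R (i + (m + 1)) = f * R (i + m) + g * R (i + (m - 1))"
        using rec[of "i + m"] by (simp add: algebra_simps)
      moreover have "R m = f * R (m - 1) + g * R (m - 1 - 1)"
        using rec[of "m - 1"] by simp
      ultimately show ?thesis
        unfolding F_def rec[of m] add_diff_cancel_right' by algebra
    qed
  qed
  then show "(k\<^sup>2 - f * k * h - g * h\<^sup>2) * R (i + n)
      + (f\<^sup>2 * h - f * k + g * h) * R i * R n
      + h * g\<^sup>2 * R (i - 1) * R (n - 1)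
      + (f * h - k) * g * (R n * R (i - 1) + R i * R (n - 1)) = 0"
    unfolding F_def .
qed

end
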